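(* Let $p\in(1,\infty)$ and $n=2$. The positive $L_p$-norm spherical copula in dimension $2$ has the density $$f(x,y)=\frac{1}{\Gamma(1-1/p)\,\Gamma(1+1/p)\,(1-x^p-y^p)^{1/p}}\,\mathbf{1}_{[x^p+y^p<1]},\qquad x>0,\ y>0.$$
   Context: For $p\in[1,\infty)$ and $x\in\mathbb{R}^n$ put $\|x\|_p=(\sum_{i=1}^n|x_i|^p)^{1/p}$. If a random vector $Z$ in $\mathbb{R}^n$ has a density of the form $g(\|x\|_p)$, then $\|Z\|_p$ and $Z/\|Z\|_p$ are independent and the law of $Z/\|Z\|_p$ does not depend on $g$ (one may take, for instance, $Z$ uniformly distributed on the unit ball $\{\|x\|_p<1\}$); this law is called the $L_p$-uniform distribution on the sphere, and $U_n$ denotes a random vector with this law. Let $U_n^+$ be the vector of componentwise absolute values of $U_n$. A random vector has an $L_p$-norm spherical distribution on $\mathbb{R}_+^n=[0,\infty)^n$ if it has the same law as $R\cdot U_n^+$, with $R\ge0$ a real random variable independent of $U_n^+$. A copula is a probability distribution on $[0,1]^n$ all of whose univariate marginals are uniform on $(0,1)$. A copula is called a positive $L_p$-norm spherical copula if it is an $L_p$-norm spherical distribution on $\mathbb{R}_+^n$; for given $n$ and $p$ there is at most one such copula. *)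

theory Defs
  imports "HOL-Probability.Probability"
begin

definition lp_norm :: "real \<Rightarrow> real ^ 'n \<Rightarrow> real" where
  "lp_norm p x = (\<Sum>i\<in>UNIV. \<bar>x $ i\<bar> powr p) powr (1 / p)"

text \<open>
  The law of \<open>Z / \<parallel>Z\<parallel>\<^sub>p\<close> is the same for every \<open>Z\<close> with a density of the form
  \<open>g (\<parallel>x\<parallel>\<^sub>p)\<close>; here \<open>Z\<close> is uniform on the open unit ball.
  The origin, where the division convention \<open>inverse 0 = 0\<close> applies, is a null set.
\<close>
definition lp_uniform :: "real \<Rightarrow> (real ^ 'n) measure" where
  "lp_uniform p =
     distr (uniform_measure lborel {x. lp_norm p x < 1}) borel (\<lambda>x. x /\<^sub>R lp_norm p x)"

definition lp_uniform_pos :: "real \<Rightarrow> (real ^ 'n) measure" where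
  "lp_uniform_pos p = distr (lp_uniform p) borel (\<lambda>u. \<chi> i. \<bar>u $ i\<bar>)"

text \<open>
  HOL cannot quantify existentially over the type of the underlying probability space.
  The type \<open>real \<times> real ^ 'n\<close> is general enough, since only the joint law of
  \<open>(R, U)\<close> matters.  Independence is spelled out by \<open>indep_set\<close>, as
  \<open>indep_var\<close> requires both random variables to have the same target type.
\<close>
definition lp_spherical_pos :: "real \<Rightarrow> (real ^ 'n) measure \<Rightarrow> bool" where
  "lp_spherical_pos p M \<longleftrightarrow>
     (\<exists>(\<Omega> :: (real \<times> real ^ 'n) measure) (R :: _ \<Rightarrow> real) (U :: _ \<Rightarrow> real ^ 'n).
        prob_space \<Omega> \<and>
        R \<in> borel_measurable \<Omega> \<and> U \<in> borel_measurable \<Omega> \<and>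
        prob_space.indep_set \<Omega>
          {R -` A \<inter> space \<Omega> | A. A \<in> sets borel}
          {U -` A \<inter> space \<Omega> | A. A \<in> sets borel} \<and>
        (\<forall>\<omega>\<in>space \<Omega>. 0 \<le> R \<omega>) \<and>
        distr \<Omega> borel U = lp_uniform_pos p \<and>
        M = distr \<Omega> borel (\<lambda>\<omega>. R \<omega> *\<^sub>R U \<omega>))"

definition copula :: "(real ^ 'n) measure \<Rightarrow> bool" where
  "copula M \<longleftrightarrow>
     prob_space M \<and> sets M = sets borel \<and>
     (AE x in M. \<forall>i. x $ i \<in> {0..1}) \<and>
     (\<forall>i. distr M borel (\<lambda>x. x $ i) = uniform_measure lborel {0<..<1})"

definition positive_lp_spherical_copula :: "real \<Rightarrow> (real ^ 'n) measure \<Rightarrow> bool" where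
  "positive_lp_spherical_copula p M \<longleftrightarrow> copula M \<and> lp_spherical_pos p M"

end

theory Submission
  imports Defs
begin

text \<open>
  Existence: substituting \<open>y = (1 - x\<^sup>p)\<^bsup>1/p\<^esup> t\<close> turns each fibre integral of the density into
  a Beta integral whose value does not depend on \<open>x \<in> (0,1)\<close>, so the marginals are uniform. The
  density depends only on the norm, and a cone meets the ball of radius \<open>r\<close> in volume proportional to
  \<open>r\<^sup>n\<close>; hence norm and direction are independent, and the direction has the law of \<open>U\<^sub>n\<^sup>+\<close>.

  Uniqueness: if \<open>R U\<^sub>n\<^sup>+\<close> has uniform marginals, then \<open>E R\<^sup>k\<close> times the \<open>k\<close>-th moment of a
  component of \<open>U\<^sub>n\<^sup>+\<close> is the (nonzero) \<open>k\<close>-th moment of the uniform law, so all moments of \<open>R\<close>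
  are determined. Since \<open>R = \<parallel>R U\<^sub>n\<^sup>+\<parallel>\<close> is bounded, they determine its law.
\<close>

subsection \<open>Laws determined by bounded moments\<close>

text \<open>The error of the \<open>n\<close>-th Taylor polynomial of the characteristic function is
  at most \<open>2 * (\<bar>t\<bar> * K) ^ n / fact n\<close>, twice a term of a convergent
  exponential series.\<close>

lemma char_bounded_moment_series:
  assumes "real_distribution M" and bound: "AE x in M. \<bar>x\<bar> \<le> K"
  shows "(\<lambda>n. \<Sum>k\<le>n. ((\<i> * complex_of_real t) ^ k / fact k) * complex_of_real (\<integral>x. x ^ k \<partial>M)) \<longlonglongrightarrow> char M t"
    (is "?S \<longlonglongrightarrow> _")
proof -
  interpret real_distribution M by fact
  have pow_bound: "AE x in M. \<bar>x ^ k\<bar> \<le> K ^ k" for k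
    using bound by eventually_elim (auto simp: power_abs intro!: power_mono)
  have int: "integrable M (\<lambda>x. x ^ k)" for k
    by (rule integrable_const_bound[where B="K ^ k"]) (use pow_bound[of k] in auto)
  have "norm (?S n - char M t) \<le> 2 * (inverse (fact n) * (\<bar>t\<bar> * K) ^ n)" for n
  proof -
    have "expectation (\<lambda>x. \<bar>x\<bar> ^ n) \<le> K ^ n"
      by (rule integral_le_const)
        (use pow_bound[of n] int[of n] in \<open>auto simp: power_abs[symmetric]\<close>)
    then have "(2 * \<bar>t\<bar> ^ n / fact n) * expectation (\<lambda>x. \<bar>x\<bar> ^ n) \<le> (2 * \<bar>t\<bar> ^ n / fact n) * K ^ n"
      by (intro mult_left_mono) auto
    with char_approx1[of n t] int
    have "norm (char M t - ?S n) \<le> (2 * \<bar>t\<bar> ^ n / fact n) * K ^ n"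
      by auto
    then show ?thesis
      by (simp add: norm_minus_commute field_simps)
  qed
  then have "\<forall>\<^sub>F n in sequentially. norm (?S n - char M t) \<le> 2 * (inverse (fact n) * (\<bar>t\<bar> * K) ^ n)"
    by simp
  moreover have "(\<lambda>n. 2 * (inverse (fact n) * (\<bar>t\<bar> * K) ^ n)) \<longlonglongrightarrow> 0"
    using tendsto_mult_left[OF summable_LIMSEQ_zero[OF summable_exp[of "\<bar>t\<bar> * K"]], of 2] by simp
  ultimately have "(\<lambda>n. ?S n - char M t) \<longlonglongrightarrow> 0"
    by (rule Lim_null_comparison)
  then show ?thesis
    using Lim_null by blast
qed

text \<open>The moments fix the Taylor polynomials, which converge to both characteristic functions;
  Levy's uniqueness theorem does the rest.\<close>

lemma real_distribution_eqI_bounded_moments: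
  assumes "real_distribution M" "real_distribution N"
    and "AE x in M. \<bar>x\<bar> \<le> K" "AE x in N. \<bar>x\<bar> \<le> K"
    and "\<And>k. (\<integral>x. x ^ k \<partial>M) = (\<integral>x. x ^ k \<partial>N)"
  shows "M = N"
proof (rule Levy_uniqueness[OF assms(1,2)], rule ext)
  fix t
  show "char M t = char N t"
    using char_bounded_moment_series[OF assms(1,3), of t] char_bounded_moment_series[OF assms(2,4), of t]
    unfolding assms(5) by (rule LIMSEQ_unique)
qed

subsection \<open>Spherical laws as images of product measures\<close>

text \<open>
  In the definition of \<open>lp_spherical_pos\<close> the type \<open>real \<times> real ^ 'n\<close> parses as
  \<open>(real \<times> real) ^ 'n\<close>, because \<open>^\<close> binds weaker than \<open>\<times>\<close>. A pair \<open>(r, u)\<close> is therefore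
  encoded below as the vector with components \<open>(r, u $ i)\<close>.
\<close>
lemma lp_spherical_pos_iff:
  fixes M :: "(real ^ 'n) measure"
  assumes "prob_space (lp_uniform_pos p :: (real ^ 'n) measure)"
  shows "lp_spherical_pos p M \<longleftrightarrow>
    (\<exists>\<rho>. real_distribution \<rho> \<and> (AE r in \<rho>. 0 \<le> r) \<and>
      M = distr (\<rho> \<Otimes>\<^sub>M lp_uniform_pos p) borel (\<lambda>(r, u). r *\<^sub>R u))"
proof
  assume "lp_spherical_pos p M"
  then obtain \<Omega> :: "(real \<times> real ^ 'n) measure" and R :: "_ \<Rightarrow> real" and U :: "_ \<Rightarrow> real ^ 'n"
    where \<Omega>: "prob_space \<Omega>" and R[measurable]: "R \<in> borel_measurable \<Omega>"
    and U[measurable]: "U \<in> borel_measurable \<Omega>"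
    and indep: "prob_space.indep_set \<Omega> {R -` A \<inter> space \<Omega> | A. A \<in> sets borel}
      {U -` A \<inter> space \<Omega> | A. A \<in> sets borel}"
    and nonneg: "\<forall>\<omega>\<in>space \<Omega>. 0 \<le> R \<omega>"
    and law: "distr \<Omega> borel U = lp_uniform_pos p"
    and M: "M = distr \<Omega> borel (\<lambda>\<omega>. R \<omega> *\<^sub>R U \<omega>)"
    unfolding lp_spherical_pos_def by blast
  interpret prob_space \<Omega> by fact
  interpret R: prob_space "distr \<Omega> borel R" by (rule prob_space_distr) fact
  interpret U: prob_space "distr \<Omega> borel U" by (rule prob_space_distr) fact
  \<comment> \<open>Independence enters here: the joint law of \<open>R\<close> and \<open>U\<close>
    agrees with the product law on rectangles, hence everywhere.\<close>
  have joint: "distr \<Omega> borel R \<Otimes>\<^sub>M distr \<Omega> borel U = distr \<Omega> (borel \<Otimes>\<^sub>M borel) (\<lambda>\<omega>. (R \<omega>, U \<omega>))"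
  proof (rule pair_measure_eqI)
    fix A B assume "A \<in> sets (distr \<Omega> borel R)" "B \<in> sets (distr \<Omega> borel U)"
    then have [measurable]: "A \<in> sets borel" "B \<in> sets borel" by auto
    have "(\<lambda>\<omega>. (R \<omega>, U \<omega>)) -` (A \<times> B) \<inter> space \<Omega> = (R -` A \<inter> space \<Omega>) \<inter> (U -` B \<inter> space \<Omega>)"
      by auto
    moreover have "prob ((R -` A \<inter> space \<Omega>) \<inter> (U -` B \<inter> space \<Omega>)) =
        prob (R -` A \<inter> space \<Omega>) * prob (U -` B \<inter> space \<Omega>)"
      by (rule indep_setD[OF indep]) auto
    ultimately show "emeasure (distr \<Omega> borel R) A * emeasure (distr \<Omega> borel U) B =
        emeasure (distr \<Omega> (borel \<Otimes>\<^sub>M borel) (\<lambda>\<omega>. (R \<omega>, U \<omega>))) (A \<times> B)"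
      by (simp add: emeasure_distr emeasure_eq_measure ennreal_mult)
  qed (auto intro: R.sigma_finite_measure_axioms U.sigma_finite_measure_axioms)
  have "M = distr (distr \<Omega> (borel \<Otimes>\<^sub>M borel) (\<lambda>\<omega>. (R \<omega>, U \<omega>))) borel (\<lambda>(r, u). r *\<^sub>R u)"
    unfolding M by (subst distr_distr) (auto simp: comp_def)
  moreover have "AE r in distr \<Omega> borel R. 0 \<le> r"
    using nonneg by (subst AE_distr_iff) auto
  ultimately show "\<exists>\<rho>. real_distribution \<rho> \<and> (AE r in \<rho>. 0 \<le> r) \<and>
      M = distr (\<rho> \<Otimes>\<^sub>M lp_uniform_pos p) borel (\<lambda>(r, u). r *\<^sub>R u)"
    unfolding joint[symmetric] law by (intro exI[of _ "distr \<Omega> borel R"]) auto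
next
  assume "\<exists>\<rho>. real_distribution \<rho> \<and> (AE r in \<rho>. 0 \<le> r) \<and>
      M = distr (\<rho> \<Otimes>\<^sub>M lp_uniform_pos p) borel (\<lambda>(r, u). r *\<^sub>R u)"
  then obtain \<rho> where "real_distribution \<rho>" and nonneg: "AE r in \<rho>. 0 \<le> r"
    and M: "M = distr (\<rho> \<Otimes>\<^sub>M lp_uniform_pos p) borel (\<lambda>(r, u). r *\<^sub>R u)"
    by blast
  define \<mu> where "\<mu> = (lp_uniform_pos p :: (real ^ 'n) measure)"
  interpret \<rho>: real_distribution \<rho> by fact
  interpret \<mu>: prob_space \<mu> using assms by (simp add: \<mu>_def)
  interpret P: pair_prob_space \<rho> \<mu> ..
  have sets_\<mu>[measurable_cong, simp]: "sets \<mu> = sets borel"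
    by (simp add: \<mu>_def lp_uniform_pos_def)
  have space_\<mu>[simp]: "space \<mu> = UNIV"
    using sets_eq_imp_space_eq[OF sets_\<mu>] by simp
  have times: "measure (\<rho> \<Otimes>\<^sub>M \<mu>) (A \<times> B) = \<rho>.prob A * \<mu>.prob B" if "A \<in> sets borel" "B \<in> sets borel" for A B
    using that \<mu>.emeasure_pair_measure_Times[of A \<rho> B]
    by (simp add: P.emeasure_eq_measure \<rho>.emeasure_eq_measure \<mu>.emeasure_eq_measure ennreal_mult[symmetric])
  define e :: "real \<times> (real ^ 'n) \<Rightarrow> (real \<times> real) ^ 'n" where "e = (\<lambda>z. \<chi> i. (fst z, snd z $ i))"
  \<comment> \<open>The absolute value gives nonnegativity everywhere, while \<open>\<rho>\<close>
    provides it only almost everywhere. All components of \<open>e z\<close> share their first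
    coordinate, so any index serves.\<close>
  define R :: "(real \<times> real) ^ 'n \<Rightarrow> real" where "R = (\<lambda>\<omega>. \<bar>fst (\<omega> $ undefined)\<bar>)"
  define U :: "(real \<times> real) ^ 'n \<Rightarrow> real ^ 'n" where "U = (\<lambda>\<omega>. \<chi> i. snd (\<omega> $ i))"
  have "e \<in> borel \<rightarrow>\<^sub>M borel"
    unfolding e_def by (intro borel_measurable_continuous_onI continuous_intros)
  then have e[measurable]: "e \<in> \<rho> \<Otimes>\<^sub>M \<mu> \<rightarrow>\<^sub>M borel"
    by (simp add: borel_prod[symmetric] measurable_cong_sets[OF sets_pair_measure_cong[OF \<rho>.events_eq_borel sets_\<mu>] refl])
  have R[measurable]: "R \<in> borel_measurable borel"
    unfolding R_def by (intro borel_measurable_continuous_onI continuous_intros)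
  have U[measurable]: "U \<in> borel_measurable borel"
    unfolding U_def by (intro borel_measurable_continuous_onI continuous_intros)
  have Re: "R (e z) = \<bar>fst z\<bar>" and Ue: "U (e z) = snd z" for z
    by (simp_all add: R_def U_def e_def vec_eq_iff)
  define \<Omega> where "\<Omega> = distr (\<rho> \<Otimes>\<^sub>M \<mu>) borel e"
  interpret \<Omega>: prob_space \<Omega>
    unfolding \<Omega>_def by (rule P.prob_space_distr) fact
  have sets_\<Omega>[measurable_cong, simp]: "sets \<Omega> = sets borel" and space_\<Omega>[simp]: "space \<Omega> = UNIV"
    by (simp_all add: \<Omega>_def)
  \<comment> \<open>With \<open>A\<close> or \<open>B\<close> equal to \<open>UNIV\<close> this also
    yields the marginal probabilities, so it gives both independence and the law of
    \<open>U\<close>.\<close>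
  have prob_\<Omega>: "\<Omega>.prob (R -` A \<inter> U -` B) = \<rho>.prob (abs -` A) * \<mu>.prob B"
    if [measurable]: "A \<in> sets borel" "B \<in> sets borel" for A B
  proof -
    have "R -` A \<in> sets borel" "U -` B \<in> sets borel"
      using measurable_sets[OF R, of A] measurable_sets[OF U, of B] by auto
    then have "\<Omega>.prob (R -` A \<inter> U -` B) = measure (\<rho> \<Otimes>\<^sub>M \<mu>) (e -` (R -` A \<inter> U -` B) \<inter> space (\<rho> \<Otimes>\<^sub>M \<mu>))"
      unfolding \<Omega>_def by (intro measure_distr) auto
    also have "e -` (R -` A \<inter> U -` B) \<inter> space (\<rho> \<Otimes>\<^sub>M \<mu>) = (abs -` A) \<times> B"
      by (auto simp: Re Ue space_pair_measure)
    also have "measure (\<rho> \<Otimes>\<^sub>M \<mu>) \<dots> = \<rho>.prob (abs -` A) * \<mu>.prob B"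
      using measurable_sets[of "abs :: real \<Rightarrow> real" borel borel A] by (intro times) auto
    finally show ?thesis .
  qed
  have "\<Omega>.indep_set {R -` A \<inter> space \<Omega> | A. A \<in> sets borel} {U -` A \<inter> space \<Omega> | A. A \<in> sets borel}"
  proof (rule \<Omega>.indep_setI)
    show "{R -` A \<inter> space \<Omega> | A. A \<in> sets borel} \<subseteq> \<Omega>.events"
      using measurable_sets[OF R] by auto
    show "{U -` A \<inter> space \<Omega> | A. A \<in> sets borel} \<subseteq> \<Omega>.events"
      using measurable_sets[OF U] by auto
    fix a b
    assume "a \<in> {R -` A \<inter> space \<Omega> | A. A \<in> sets borel}" "b \<in> {U -` A \<inter> space \<Omega> | A. A \<in> sets borel}"
    then obtain A B where "A \<in> sets borel" "B \<in> sets borel" "a = R -` A" "b = U -` B"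
      by auto
    then show "\<Omega>.prob (a \<inter> b) = \<Omega>.prob a * \<Omega>.prob b"
      using prob_\<Omega>[of A UNIV] prob_\<Omega>[of UNIV B] prob_\<Omega>[of A B] \<rho>.prob_space \<mu>.prob_space by simp
  qed
  moreover have "distr \<Omega> borel U = \<mu>"
  proof (rule measure_eqI)
    fix B assume "B \<in> sets (distr \<Omega> borel U)"
    then show "emeasure (distr \<Omega> borel U) B = emeasure \<mu> B"
      using prob_\<Omega>[of UNIV B] \<rho>.prob_space
      by (simp add: emeasure_distr \<Omega>.emeasure_eq_measure \<mu>.emeasure_eq_measure)
  qed simp
  moreover have "M = distr \<Omega> borel (\<lambda>\<omega>. R \<omega> *\<^sub>R U \<omega>)"
  proof -
    \<comment> \<open>The radius is almost surely nonnegative, so passing to its absolute value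
      leaves the law of the product unchanged.\<close>
    have "{x \<in> space (\<rho> \<Otimes>\<^sub>M \<mu>). 0 \<le> fst x} \<in> sets (\<rho> \<Otimes>\<^sub>M \<mu>)"
      by measurable
    then have "AE x in \<rho> \<Otimes>\<^sub>M \<mu>. 0 \<le> fst x"
      by (rule P.AE_pair_measure) (use nonneg in \<open>auto elim: eventually_mono\<close>)
    then have "AE x in \<rho> \<Otimes>\<^sub>M \<mu>. (case x of (r, u) \<Rightarrow> r *\<^sub>R u) = R (e x) *\<^sub>R U (e x)"
      by eventually_elim (auto simp: Re Ue)
    then have "M = distr (\<rho> \<Otimes>\<^sub>M \<mu>) borel (\<lambda>x. R (e x) *\<^sub>R U (e x))"
      unfolding M \<mu>_def[symmetric] by (intro distr_cong_AE) auto
    then show ?thesis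
      unfolding \<Omega>_def by (subst distr_distr) (auto simp: comp_def)
  qed
  moreover have "R \<in> borel_measurable \<Omega>" "U \<in> borel_measurable \<Omega>" "\<forall>\<omega>\<in>space \<Omega>. 0 \<le> R \<omega>"
    using R U by (auto simp: R_def cong: measurable_cong_sets)
  ultimately show "lp_spherical_pos p M"
    unfolding lp_spherical_pos_def \<mu>_def[symmetric] using \<Omega>.prob_space_axioms by blast
qed

subsection \<open>Integration on the plane and a Beta integral\<close>

lemma measurable_vector2 [measurable (raw)]:
  assumes [measurable]: "f \<in> borel_measurable M" "g \<in> borel_measurable M"
  shows "(\<lambda>x. vector [f x, g x] :: real ^ 2) \<in> borel_measurable M"
  by (subst borel_measurable_euclidean_space)
    (auto simp: Basis_vec_def inner_axis UNIV_2)

text \<open>Lebesgue measure is characterised by its values on boxes, and a box pulls back to a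
  rectangle under the coordinate map. This opens the plane to Tonelli's theorem.\<close>

lemma lborel_vec2_eq:
  "(lborel :: (real ^ 2) measure) = distr (lborel \<Otimes>\<^sub>M lborel) borel (\<lambda>(x, y). vector [x, y])"
proof (rule lborel_eqI)
  fix l u :: "real ^ 2"
  assume "\<And>b. b \<in> Basis \<Longrightarrow> l \<bullet> b \<le> u \<bullet> b"
  then have le: "l $ i \<le> u $ i" for i
    by (metis cart_eq_inner_axis axis_in_Basis_iff Basis_real_def singletonI inner_real_def)
  have "(\<lambda>(x, y). vector [x, y] :: real ^ 2) -` box l u = {l $ 1 <..< u $ 1} \<times> {l $ 2 <..< u $ 2}"
    by (auto simp: mem_box_cart forall_2)
  then have "emeasure (distr (lborel \<Otimes>\<^sub>M lborel) borel (\<lambda>(x, y). vector [x, y])) (box l u) =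
      emeasure (lborel \<Otimes>\<^sub>M lborel) ({l $ 1 <..< u $ 1} \<times> {l $ 2 <..< u $ 2})"
    by (subst emeasure_distr) (auto simp: space_pair_measure)
  also have "\<dots> = ennreal ((u $ 1 - l $ 1) * (u $ 2 - l $ 2))"
    using le by (subst lborel.emeasure_pair_measure_Times) (auto simp: ennreal_mult)
  also have "(u $ 1 - l $ 1) * (u $ 2 - l $ 2) = (\<Prod>b\<in>Basis. (u - l) \<bullet> b)"
    by (simp add: Basis_vec_def axis_eq_axis inner_axis UNIV_2 image_UN prod.UNION_disjoint)
  finally show "emeasure (distr (lborel \<Otimes>\<^sub>M lborel) borel (\<lambda>(x, y). vector [x, y])) (box l u) =
      ennreal (\<Prod>b\<in>Basis. (u - l) \<bullet> b)" .
qed simp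

lemma nn_integral_lborel_vec2:
  fixes f :: "real ^ 2 \<Rightarrow> ennreal"
  assumes [measurable]: "f \<in> borel_measurable borel"
  shows "(\<integral>\<^sup>+v. f v \<partial>lborel) = (\<integral>\<^sup>+x. \<integral>\<^sup>+y. f (vector [x, y]) \<partial>lborel \<partial>lborel)"
proof -
  have "(\<integral>\<^sup>+v. f v \<partial>lborel) = (\<integral>\<^sup>+z. f (case z of (x, y) \<Rightarrow> vector [x, y]) \<partial>(lborel \<Otimes>\<^sub>M lborel))"
    by (subst lborel_vec2_eq, subst nn_integral_distr) auto
  also have "\<dots> = (\<integral>\<^sup>+x. \<integral>\<^sup>+y. f (vector [x, y]) \<partial>lborel \<partial>lborel)"
    by (subst lborel.nn_integral_fst[symmetric]) auto
  finally show ?thesis .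
qed

text \<open>The substitution \<open>s = t powr p\<close> turns the integral into
  \<open>Beta (1 / p) (1 - 1 / p) / p\<close>; both parameters are positive because
  \<open>1 < p\<close>, and \<open>Gamma (1 + 1 / p) = Gamma (1 / p) / p\<close>.\<close>

lemma nn_integral_one_minus_powr:
  fixes p :: real
  assumes "1 < p"
  shows "(\<integral>\<^sup>+t. ennreal (indicator {0<..<1} t * (1 - t powr p) powr (- (1 / p))) \<partial>lborel) =
    ennreal (Gamma (1 - 1 / p) * Gamma (1 + 1 / p))"
proof -
  \<comment> \<open>Chosen so that the Jacobian \<open>p * t powr (p - 1)\<close> times
    \<open>f (t powr p)\<close> is the original integrand.\<close>
  define f where "f = (\<lambda>s::real. s powr (1 / p - 1) * (1 - s) powr (- (1 / p)) / p)"
  have image: "(\<lambda>t. t powr p) ` {0<..<1::real} = {0<..<1}"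
  proof -
    have "s \<in> (\<lambda>t. t powr p) ` {0<..<1::real}" if "s \<in> {0<..<1}" for s
      by (rule image_eqI[of _ _ "s powr (1 / p)"])
        (use that assms powr_less_mono2[of "1 / p" s 1] in \<open>auto simp: powr_powr\<close>)
    moreover have "t powr p \<in> {0<..<1}" if "t \<in> {0<..<1}" for t :: real
      using that assms powr_less_mono2[of p t 1] by auto
    ultimately show ?thesis by auto
  qed
  have "((\<lambda>s. s powr (1 / p - 1) * (1 - s) powr (1 - 1 / p - 1)) has_integral Beta (1 / p) (1 - 1 / p)) {0<..<1}"
    using has_integral_Beta_real[of "1 / p" "1 - 1 / p"] assms
    by (simp add: has_integral_Icc_iff_Ioo)
  then have "(f has_integral (1 / p) * Beta (1 / p) (1 - 1 / p)) {0<..<1}"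
    unfolding f_def by (drule_tac has_integral_mult_right[where c="1 / p"]) (simp add: mult_ac)
  also have "(1 / p) * Beta (1 / p) (1 - 1 / p) = Gamma (1 - 1 / p) * Gamma (1 + 1 / p)"
  proof -
    have "1 / p \<notin> \<int>\<^sub>\<le>\<^sub>0"
      using assms nonpos_Ints_nonpos[of "1 / p"] by (auto simp: field_simps)
    then show ?thesis
      using Gamma_plus1[of "1 / p"] by (simp add: Beta_def add.commute mult.commute)
  qed
  finally have f: "(f has_integral Gamma (1 - 1 / p) * Gamma (1 + 1 / p)) {0<..<1}" .
  then have "f absolutely_integrable_on {0<..<1}"
    by (intro nonnegative_absolutely_integrable_1) (use assms in \<open>auto simp: f_def has_integral_integrable\<close>)
  with f have "f absolutely_integrable_on (\<lambda>t. t powr p) ` {0<..<1} \<and>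
      integral ((\<lambda>t. t powr p) ` {0<..<1}) f = Gamma (1 - 1 / p) * Gamma (1 + 1 / p)"
    unfolding image by blast
  also have "?this \<longleftrightarrow> (\<lambda>t. \<bar>p * t powr (p - 1)\<bar> * f (t powr p)) absolutely_integrable_on {0<..<1} \<and>
      integral {0<..<1} (\<lambda>t. \<bar>p * t powr (p - 1)\<bar> * f (t powr p)) = Gamma (1 - 1 / p) * Gamma (1 + 1 / p)"
  proof (rule has_absolute_integral_change_of_variables_1'[symmetric])
    show "inj_on (\<lambda>t. t powr p) {0<..<1}"
      by (rule inj_on_inverseI[where g="\<lambda>s. s powr (1 / p)"]) (use assms in \<open>auto simp: powr_powr\<close>)
    show "((\<lambda>t. t powr p) has_field_derivative p * t powr (p - 1)) (at t within {0<..<1})"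
      if "t \<in> {0<..<1}" for t
      using that has_real_derivative_powr[of t p] has_field_derivative_at_within by auto
  qed simp
  finally have "((\<lambda>t. \<bar>p * t powr (p - 1)\<bar> * f (t powr p)) has_integral
      Gamma (1 - 1 / p) * Gamma (1 + 1 / p)) {0<..<1}"
    by (simp add: has_integral_iff set_lebesgue_integral_eq_integral(1))
  moreover have "\<bar>p * t powr (p - 1)\<bar> * f (t powr p) = (1 - t powr p) powr (- (1 / p))"
    if "t \<in> {0<..<1}" for t
  proof -
    have "t powr (p - 1) * (t powr p) powr (1 / p - 1) = 1"
      using that assms by (simp add: powr_powr powr_add[symmetric] algebra_simps)
    then show ?thesis using assms by (simp add: f_def abs_mult mult.assoc[symmetric])
  qed
  ultimately have "((\<lambda>t. (1 - t powr p) powr (- (1 / p))) has_integral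
      Gamma (1 - 1 / p) * Gamma (1 + 1 / p)) {0<..<1}"
    by (rule has_integral_eq[rotated]) 
  from nn_integral_has_integral_lebesgue[OF _ this] show ?thesis by simp
qed

subsection \<open>The \<open>L\<^sub>p\<close>-norm and integration over cones\<close>

lemma borel_measurable_vec_abs [measurable]: "(\<lambda>v :: real ^ 'n. \<chi> i. \<bar>v $ i\<bar>) \<in> borel_measurable borel"
  by (intro borel_measurable_continuous_onI continuous_intros)

lemma lp_norm_nonneg: "0 \<le> lp_norm p x"
  by (simp add: lp_norm_def)

lemma borel_measurable_lp_norm [measurable]: "lp_norm p \<in> borel_measurable borel"
  unfolding lp_norm_def[abs_def] by measurable

lemma lp_norm_scaleR:
  assumes "0 < p"
  shows "lp_norm p (c *\<^sub>R x) = \<bar>c\<bar> * lp_norm p x"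
proof -
  have "(\<Sum>i\<in>UNIV. \<bar>(c *\<^sub>R x) $ i\<bar> powr p) = \<bar>c\<bar> powr p * (\<Sum>i\<in>UNIV. \<bar>x $ i\<bar> powr p)"
    by (simp add: abs_mult powr_mult sum_distrib_left)
  then show ?thesis
    using assms by (simp add: lp_norm_def powr_mult sum_nonneg powr_powr)
qed

lemma lp_norm_abs: "lp_norm p (\<chi> i. \<bar>x $ i\<bar>) = lp_norm p x"
  by (simp add: lp_norm_def)

lemma component_le_lp_norm:
  assumes "0 < p"
  shows "\<bar>x $ i\<bar> \<le> lp_norm p x"
proof -
  have "\<bar>x $ i\<bar> powr p \<le> (\<Sum>i\<in>UNIV. \<bar>x $ i\<bar> powr p)"
    by (rule member_le_sum) auto
  then have "(\<bar>x $ i\<bar> powr p) powr (1 / p) \<le> lp_norm p x"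
    unfolding lp_norm_def using assms by (intro powr_mono2) auto
  then show ?thesis
    using assms by (simp add: powr_powr)
qed

lemma lp_norm_eq_0_iff:
  assumes "0 < p"
  shows "lp_norm p x = 0 \<longleftrightarrow> x = 0"
proof
  show "lp_norm p x = 0 \<Longrightarrow> x = 0"
    using component_le_lp_norm[OF assms, of x] by (simp add: vec_eq_iff)
  show "x = 0 \<Longrightarrow> lp_norm p x = 0"
    using lp_norm_scaleR[OF assms, of 0 x] by simp
qed

text \<open>Every component is bounded by the norm, so the ball lies in a cube.\<close>

lemma emeasure_lp_ball_finite:
  assumes "0 < p"
  shows "emeasure lborel {x :: real ^ 'n. lp_norm p x < 1} < \<infinity>"
proof -
  have "{x :: real ^ 'n. lp_norm p x < 1} \<subseteq> cbox (\<chi> i. -1) (\<chi> i. 1)"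
  proof
    fix x :: "real ^ 'n" assume "x \<in> {x. lp_norm p x < 1}"
    then have "\<bar>x $ i\<bar> < 1" for i
      using component_le_lp_norm[OF assms, of x i] by simp
    then show "x \<in> cbox (\<chi> i. -1) (\<chi> i. 1)"
      by (auto simp: mem_box_cart abs_less_iff less_imp_le minus_le_iff)
  qed
  then have "emeasure lborel {x :: real ^ 'n. lp_norm p x < 1} \<le> emeasure lborel (cbox (\<chi> i. -1) (\<chi> i. 1) :: (real ^ 'n) set)"
    by (rule emeasure_mono) simp
  also have "\<dots> < \<infinity>"
    by (rule emeasure_lborel_cbox_finite)
  finally show ?thesis .
qed

section \<open>Scaling of volumes and polar integration over cones\<close>

lemma nn_integral_lborel_scaleR:
  fixes f :: "'a :: euclidean_space \<Rightarrow> ennreal"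
  assumes [measurable]: "f \<in> borel_measurable borel" and "c \<noteq> 0"
  shows "(\<integral>\<^sup>+x. f x \<partial>lborel) = ennreal (\<bar>c\<bar> ^ DIM('a)) * (\<integral>\<^sup>+x. f (c *\<^sub>R x) \<partial>lborel)"
  by (subst lborel_affine[OF \<open>c \<noteq> 0\<close>, of 0])
    (simp add: nn_integral_density nn_integral_distr nn_integral_cmult ennreal_power)

text \<open>Dilation by \<open>r\<close> carries the part in the unit ball onto the part in the ball
  of radius \<open>r\<close> and multiplies volume by \<open>r ^ CARD('n)\<close>.\<close>

lemma emeasure_cone_lp_ball:
  fixes C :: "(real ^ 'n) set"
  assumes "0 < p" and [measurable]: "C \<in> sets borel"
    and cone: "\<And>c x. 0 < c \<Longrightarrow> c *\<^sub>R x \<in> C \<longleftrightarrow> x \<in> C" and "0 < r"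
  shows "emeasure lborel {x \<in> C. lp_norm p x < r} =
    ennreal (r ^ CARD('n)) * emeasure lborel {x \<in> C. lp_norm p x < 1}"
proof -
  have "emeasure lborel {x \<in> C. lp_norm p x < r} = (\<integral>\<^sup>+x. indicator {x \<in> C. lp_norm p x < r} x \<partial>lborel)"
    by simp
  also have "\<dots> = ennreal (r ^ CARD('n)) * (\<integral>\<^sup>+x. indicator {x \<in> C. lp_norm p x < r} (r *\<^sub>R x) \<partial>lborel)"
    using \<open>0 < r\<close> by (subst nn_integral_lborel_scaleR[of _ r]) auto
  also have "(\<lambda>x. indicator {x \<in> C. lp_norm p x < r} (r *\<^sub>R x)) = (indicator {x \<in> C. lp_norm p x < 1} :: _ \<Rightarrow> ennreal)"
    using \<open>0 < r\<close> \<open>0 < p\<close> by (auto simp: fun_eq_iff indicator_def cone lp_norm_scaleR)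
  finally show ?thesis by simp
qed

lemma nn_integral_power_deriv:
  fixes r :: real
  assumes "0 < n" "0 \<le> r"
  shows "(\<integral>\<^sup>+s. ennreal (indicator {0<..} s * (real n * s ^ (n - 1))) * indicator {..<r} s \<partial>lborel) = ennreal (r ^ n)"
proof -
  have "(\<integral>\<^sup>+s. ennreal (indicator {0<..} s * (real n * s ^ (n - 1))) * indicator {..<r} s \<partial>lborel) =
      (\<integral>\<^sup>+s. ennreal (real n * s ^ (n - 1)) * indicator {0..r} s \<partial>lborel)"
    \<comment> \<open>The integrands differ at most at \<open>0\<close> and \<open>r\<close>; the
      first point matters for \<open>n = 1\<close>, where \<open>0 ^ 0 = 1\<close>.\<close>
    by (intro nn_integral_cong_AE eventually_mono[OF eventually_conj[OF AE_lborel_singleton[of 0] AE_lborel_singleton[of r]]])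
      (auto simp: indicator_def)
  also have "\<dots> = ennreal (r ^ n - 0 ^ n)"
    using assms by (intro nn_integral_FTC_Icc) (auto intro!: derivative_eq_intros)
  finally show ?thesis
    using assms by (simp add: power_0_left)
qed

text \<open>
  Polar integration over a cone without a Jacobian: by homogeneity the part of the cone inside the
  ball of radius \<open>r\<close> has volume proportional to \<open>r ^ n\<close>, which determines the law of the norm.
\<close>
lemma nn_integral_cone_lp_norm:
  fixes C :: "(real ^ 'n) set" and h :: "real \<Rightarrow> ennreal"
  assumes p: "0 < p" and C[measurable]: "C \<in> sets borel"
    and cone: "\<And>c x. 0 < c \<Longrightarrow> c *\<^sub>R x \<in> C \<longleftrightarrow> x \<in> C"
    and h[measurable]: "h \<in> borel_measurable borel"
  shows "(\<integral>\<^sup>+x. indicator C x * h (lp_norm p x) \<partial>lborel) =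
    emeasure lborel {x \<in> C. lp_norm p x < 1} *
      (\<integral>\<^sup>+r. ennreal (indicator {0<..} r * (real CARD('n) * r ^ (CARD('n) - 1))) * h r \<partial>lborel)"
proof -
  define K where "K = emeasure lborel {x \<in> C. lp_norm p x < 1}"
  define w where "w = (\<lambda>r::real. ennreal (indicator {0<..} r * (real CARD('n) * r ^ (CARD('n) - 1))))"
  have [measurable]: "w \<in> borel_measurable borel"
    by (simp add: w_def)
  have "K \<le> emeasure lborel {x :: real ^ 'n. lp_norm p x < 1}"
    unfolding K_def by (rule emeasure_mono) auto
  then have K: "K < \<infinity>"
    using emeasure_lp_ball_finite[OF p] by (rule le_less_trans)
  have below: "emeasure (distr (density lborel (indicator C)) borel (lp_norm p)) {..<r} =
      emeasure lborel {x \<in> C. lp_norm p x < r}" for r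
  proof -
    have "emeasure (distr (density lborel (indicator C)) borel (lp_norm p)) {..<r} =
        (\<integral>\<^sup>+x. indicator C x * indicator {x. lp_norm p x < r} x \<partial>lborel)"
      by (subst emeasure_distr) (auto simp: emeasure_density vimage_def)
    also have "\<dots> = (\<integral>\<^sup>+x. indicator {x \<in> C. lp_norm p x < r} x \<partial>lborel)"
      by (intro nn_integral_cong) (auto simp: indicator_def)
    finally show ?thesis by simp
  qed
  \<comment> \<open>On half-lines both measures give \<open>K * r ^ CARD('n)\<close> for positive
    \<open>r\<close>, and \<open>0\<close> otherwise.\<close>
  have eq: "emeasure (distr (density lborel (indicator C)) borel (lp_norm p)) {..<r} =
      emeasure (density lborel (\<lambda>r. K * w r)) {..<r}" for r
  proof (cases "0 < r")
    case True
    have "emeasure (density lborel (\<lambda>r. K * w r)) {..<r} = K * ennreal (r ^ CARD('n))"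
      using True nn_integral_power_deriv[of "CARD('n)" r]
      by (simp add: emeasure_density mult.assoc nn_integral_cmult w_def)
    also have "\<dots> = emeasure lborel {x \<in> C. lp_norm p x < r}"
      by (simp add: emeasure_cone_lp_ball[OF p C cone True] K_def mult.commute)
    finally show ?thesis by (simp add: below)
  next
    case False
    then have "{x \<in> C. lp_norm p x < r} = {}"
      using lp_norm_nonneg[of p] by (auto simp: not_less intro: order_trans)
    moreover have "K * w s * indicator {..<r} s = 0" for s
      using False by (auto simp: w_def indicator_def)
    then have "emeasure (density lborel (\<lambda>r. K * w r)) {..<r} = 0"
      by (subst emeasure_density) (simp_all only: nn_integral_const mult_zero_left, measurable)
    ultimately show ?thesis
      by (simp only: below emeasure_empty)
  qed
  have "distr (density lborel (indicator C)) borel (lp_norm p) = density lborel (\<lambda>r. K * w r)"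
  proof (rule measure_eqI_generator_eq[where E="range lessThan" and \<Omega>=UNIV and A="\<lambda>i. {..<real i}"])
    show "Int_stable (range lessThan :: real set set)"
    proof (rule Int_stableI_image)
      show "\<exists>k\<in>UNIV. {..<i} \<inter> {..<j} = {..<k}" for i j :: real
        by (intro bexI[of _ "min i j"]) auto
    qed
    have borel: "sets (borel :: real measure) = sigma_sets UNIV (range lessThan)"
      by (simp add: borel_eq_lessThan eucl_lessThan)
    then show "sets (distr (density lborel (indicator C)) borel (lp_norm p)) = sigma_sets UNIV (range lessThan)"
      and "sets (density lborel (\<lambda>r. K * w r)) = sigma_sets UNIV (range lessThan)"
      by simp_all
    show "(\<Union>i. {..<real i}) = UNIV"
      by (auto intro: reals_Archimedean2)
    \<comment> \<open>Finiteness on an exhausting sequence of half-lines; \<open>i = 0\<close>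
      stands apart because the scaling formula requires a positive radius.\<close>
    show "emeasure (distr (density lborel (indicator C)) borel (lp_norm p)) {..<real i} \<noteq> \<infinity>" for i
    proof (cases "i = 0")
      case True
      then have "{x \<in> C. lp_norm p x < real i} = {}"
        using lp_norm_nonneg[of p] by (auto simp: not_less)
      then show ?thesis
        by (simp only: below emeasure_empty) simp
    next
      case False
      then show ?thesis
        using K by (simp add: below emeasure_cone_lp_ball[OF p C cone, of "real i"] K_def ennreal_mult_eq_top_iff)
    qed
    show "emeasure (distr (density lborel (indicator C)) borel (lp_norm p)) X = emeasure (density lborel (\<lambda>r. K * w r)) X"
      if "X \<in> range lessThan" for X
      using that eq by blast
  qed auto
  then have "(\<integral>\<^sup>+r. h r \<partial>distr (density lborel (indicator C)) borel (lp_norm p)) =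
      (\<integral>\<^sup>+r. h r \<partial>density lborel (\<lambda>r. K * w r))"
    by simp
  then show ?thesis
    by (simp add: nn_integral_distr nn_integral_density mult.assoc nn_integral_cmult K_def w_def)
qed

text \<open>The origin is a null set, and reflection at it preserves Lebesgue measure.\<close>

lemma nn_integral_lborel_abs:
  fixes f :: "real \<Rightarrow> ennreal"
  assumes [measurable]: "f \<in> borel_measurable borel"
  shows "(\<integral>\<^sup>+x. f \<bar>x\<bar> \<partial>lborel) = 2 * (\<integral>\<^sup>+x. indicator {0<..} x * f x \<partial>lborel)"
proof -
  have "(\<integral>\<^sup>+x. f \<bar>x\<bar> \<partial>lborel) = (\<integral>\<^sup>+x. indicator {0<..} x * f x + indicator {0<..} (- x) * f (- x) \<partial>lborel)"
    by (intro nn_integral_cong_AE eventually_mono[OF AE_lborel_singleton[of 0]])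
      (auto simp: indicator_def abs_if)
  also have "\<dots> = (\<integral>\<^sup>+x. indicator {0<..} x * f x \<partial>lborel) + (\<integral>\<^sup>+x. indicator {0<..} (- x) * f (- x) \<partial>lborel)"
    by (rule nn_integral_add) auto
  also have "(\<integral>\<^sup>+x. indicator {0<..} (- x) * f (- x) \<partial>lborel) = (\<integral>\<^sup>+x. indicator {0<..} x * f x \<partial>lborel)"
    by (subst (2) nn_integral_real_affine[where c="-1" and t=0]) auto
  finally show ?thesis by (simp add: mult_2)
qed

text \<open>Folding each coordinate in turn contributes a factor \<open>2\<close>, which accounts
  for the four quadrants.\<close>

lemma nn_integral_lborel_vec2_abs:
  fixes f :: "real ^ 2 \<Rightarrow> ennreal"
  assumes [measurable]: "f \<in> borel_measurable borel"
  shows "(\<integral>\<^sup>+v. f (\<chi> i. \<bar>v $ i\<bar>) \<partial>lborel) = 4 * (\<integral>\<^sup>+v. indicator {v. 0 < v $ 1 \<and> 0 < v $ 2} v * f v \<partial>lborel)"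
proof -
  have abs_vector: "(\<chi> i. \<bar>vector [x, y] $ i\<bar>) = (vector [\<bar>x\<bar>, \<bar>y\<bar>] :: real ^ 2)" for x y :: real
    by (simp add: vec_eq_iff forall_2)
  have "(\<integral>\<^sup>+v. f (\<chi> i. \<bar>v $ i\<bar>) \<partial>lborel) = (\<integral>\<^sup>+x. \<integral>\<^sup>+y. f (vector [\<bar>x\<bar>, \<bar>y\<bar>]) \<partial>lborel \<partial>lborel)"
    by (subst nn_integral_lborel_vec2) (auto simp: abs_vector)
  also have "\<dots> = (\<integral>\<^sup>+x. 2 * (\<integral>\<^sup>+y. indicator {0<..} y * f (vector [\<bar>x\<bar>, y]) \<partial>lborel) \<partial>lborel)"
    by (subst nn_integral_lborel_abs) auto
  also have "\<dots> = 2 * (\<integral>\<^sup>+x. (\<integral>\<^sup>+y. indicator {0<..} y * f (vector [\<bar>x\<bar>, y]) \<partial>lborel) \<partial>lborel)"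
    by (rule nn_integral_cmult) auto
  also have "(\<integral>\<^sup>+x. (\<integral>\<^sup>+y. indicator {0<..} y * f (vector [\<bar>x\<bar>, y]) \<partial>lborel) \<partial>lborel) =
      2 * (\<integral>\<^sup>+x. indicator {0<..} x * (\<integral>\<^sup>+y. indicator {0<..} y * f (vector [x, y]) \<partial>lborel) \<partial>lborel)"
    by (rule nn_integral_lborel_abs) auto
  also have "(\<integral>\<^sup>+x. indicator {0<..} x * (\<integral>\<^sup>+y. indicator {0<..} y * f (vector [x, y]) \<partial>lborel) \<partial>lborel) =
      (\<integral>\<^sup>+x. \<integral>\<^sup>+y. indicator {v :: real ^ 2. 0 < v $ 1 \<and> 0 < v $ 2} (vector [x, y]) * f (vector [x, y]) \<partial>lborel \<partial>lborel)"
    by (intro nn_integral_cong, subst nn_integral_cmult[symmetric])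
      (auto simp: indicator_def intro!: nn_integral_cong)
  also have "\<dots> = (\<integral>\<^sup>+v. indicator {v. 0 < v $ 1 \<and> 0 < v $ 2} v * f v \<partial>lborel)"
    by (subst nn_integral_lborel_vec2) auto
  finally show ?thesis by (simp add: mult.assoc[symmetric])
qed

subsection \<open>Uniqueness\<close>

lemma lp_uniform_pos_eq_distr:
  "lp_uniform_pos p = distr (uniform_measure lborel {v :: real ^ 'n. lp_norm p v < 1}) borel
    (\<lambda>v. \<chi> i. \<bar>(v /\<^sub>R lp_norm p v) $ i\<bar>)"
  unfolding lp_uniform_pos_def lp_uniform_def by (subst distr_distr) (auto simp: comp_def)

text \<open>Normalising a nonzero vector gives norm \<open>1\<close> by homogeneity, and the origin
  is a null set. Hence the radius of a spherical vector can be recovered as its norm.\<close>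

lemma AE_lp_norm_lp_uniform_pos:
  assumes "0 < p"
  shows "AE u in (lp_uniform_pos p :: (real ^ 'n) measure). lp_norm p u = 1"
proof -
  have "AE v in uniform_measure lborel {v :: real ^ 'n. lp_norm p v < 1}. v \<noteq> 0"
    by (rule AE_uniform_measureI) (use AE_lborel_singleton[of "0 :: real ^ 'n"] in auto)
  moreover have "lp_norm p (v /\<^sub>R lp_norm p v) = 1" if "v \<noteq> 0" for v :: "real ^ 'n"
    using that assms lp_norm_nonneg[of p v] by (simp add: lp_norm_scaleR lp_norm_eq_0_iff)
  ultimately have "AE v in uniform_measure lborel {v :: real ^ 'n. lp_norm p v < 1}. lp_norm p (v /\<^sub>R lp_norm p v) = 1"
    by (auto elim: eventually_mono)
  then show ?thesis
    unfolding lp_uniform_pos_eq_distr by (subst AE_distr_iff) (simp_all only: lp_norm_abs, measurable)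
qed

lemma nn_integral_pair_prod:
  fixes f g :: "_ \<Rightarrow> ennreal"
  assumes "sigma_finite_measure N" and [measurable]: "f \<in> borel_measurable M" "g \<in> borel_measurable N"
  shows "(\<integral>\<^sup>+z. f (fst z) * g (snd z) \<partial>(M \<Otimes>\<^sub>M N)) = (\<integral>\<^sup>+x. f x \<partial>M) * (\<integral>\<^sup>+y. g y \<partial>N)"
proof -
  interpret N: sigma_finite_measure N by fact
  show ?thesis
    by (subst N.nn_integral_fst[symmetric]) (auto simp: nn_integral_cmult nn_integral_multc)
qed

text \<open>Valid in every dimension, with the probability property of the direction law as an
  assumption; in dimension two that property comes out of the existence proof. Moments of the radius
  are compared through a single component.\<close>

lemma positive_lp_spherical_copula_unique:
  fixes M N :: "(real ^ 'n) measure"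
  assumes p: "0 < p" and prob: "prob_space (lp_uniform_pos p :: (real ^ 'n) measure)"
    and M: "positive_lp_spherical_copula p M" and N: "positive_lp_spherical_copula p N"
  shows "M = N"
proof -
  define \<mu> where "\<mu> = (lp_uniform_pos p :: (real ^ 'n) measure)"
  interpret \<mu>: prob_space \<mu> using prob by (simp add: \<mu>_def)
  have sets_\<mu>[measurable_cong, simp]: "sets \<mu> = sets borel"
    by (simp add: \<mu>_def lp_uniform_pos_def)
  \<comment> \<open>Absolute moments taken as nonnegative integrals factorise without any proof of
    integrability; ordinary moments come back through \<open>abs_moment\<close>.\<close>
  define c where "c k = (\<integral>\<^sup>+x. ennreal (\<bar>x\<bar> ^ k) \<partial>uniform_measure lborel {0<..<1::real})" for k
  interpret U: prob_space "uniform_measure lborel {0<..<1::real}"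
    by (rule prob_space_uniform_measure) auto
  have U: "AE x in uniform_measure lborel {0<..<1::real}. x \<in> {0<..<1}"
    by (rule AE_uniform_measureI) auto
  have c_0: "c k \<noteq> 0" for k
  proof
    assume "c k = 0"
    then have "AE x in uniform_measure lborel {0<..<1::real}. ennreal (\<bar>x\<bar> ^ k) = 0"
      unfolding c_def by (subst (asm) nn_integral_0_iff_AE) auto
    with U have "AE x in uniform_measure lborel {0<..<1::real}. False"
      by eventually_elim auto
    then show False by simp
  qed
  have c_top: "c k \<noteq> \<top>" for k
  proof -
    have "c k \<le> (\<integral>\<^sup>+x. 1 \<partial>uniform_measure lborel {0<..<1::real})"
      unfolding c_def using U
      by (intro nn_integral_mono_AE, elim eventually_mono) (auto intro!: power_le_one)
    also have "\<dots> = 1"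
      using U.emeasure_space_1 by simp
    finally show ?thesis by (auto simp: top_unique)
  qed
  \<comment> \<open>\<open>undefined\<close> is an arbitrary component: every marginal of a copula
    is uniform.\<close>
  define m where "m k = (\<integral>\<^sup>+u. ennreal (\<bar>u $ undefined\<bar> ^ k) \<partial>\<mu>)" for k
  \<comment> \<open>The norm of the all-ones vector, the largest norm on the unit cube.\<close>
  define K where "K = real CARD('n) powr (1 / p)"
  have *: "(\<integral>\<^sup>+r. ennreal (\<bar>r\<bar> ^ k) \<partial>\<rho>) * m k = c k" "AE r in \<rho>. \<bar>r\<bar> \<le> K"
    if \<rho>: "real_distribution \<rho>" and L: "L = distr (\<rho> \<Otimes>\<^sub>M \<mu>) borel (\<lambda>(r, u). r *\<^sub>R u)" and "copula L"
    for L :: "(real ^ 'n) measure" and \<rho> k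
  proof -
    interpret \<rho>: real_distribution \<rho> by fact
    interpret P: pair_prob_space \<rho> \<mu> ..
    have [measurable]: "(\<lambda>v :: real ^ 'n. v $ undefined) \<in> borel_measurable borel"
      by measurable
    have "c k = (\<integral>\<^sup>+x. ennreal (\<bar>x\<bar> ^ k) \<partial>distr L borel (\<lambda>v. v $ undefined))"
      using \<open>copula L\<close> by (simp add: copula_def c_def)
    also have "\<dots> = (\<integral>\<^sup>+z. ennreal (\<bar>fst z\<bar> ^ k) * ennreal (\<bar>snd z $ undefined\<bar> ^ k) \<partial>(\<rho> \<Otimes>\<^sub>M \<mu>))"
      unfolding L
      by (simp add: nn_integral_distr split_beta abs_mult power_mult_distrib ennreal_mult[symmetric])
    also have "\<dots> = (\<integral>\<^sup>+r. ennreal (\<bar>r\<bar> ^ k) \<partial>\<rho>) * m k"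
      unfolding m_def by (rule nn_integral_pair_prod[OF \<mu>.sigma_finite_measure_axioms]) measurable
    finally show "(\<integral>\<^sup>+r. ennreal (\<bar>r\<bar> ^ k) \<partial>\<rho>) * m k = c k" ..
    have "lp_norm p x \<le> K" if "\<forall>i. x $ i \<in> {0..1}" for x :: "real ^ 'n"
    proof -
      have "(\<Sum>i\<in>UNIV. \<bar>x $ i\<bar> powr p) \<le> (\<Sum>i\<in>(UNIV :: 'n set). 1)"
        using that p by (intro sum_mono powr_le1) auto
      then show ?thesis
        unfolding lp_norm_def K_def using p by (intro powr_mono2 sum_nonneg) auto
    qed
    moreover have "AE x in L. \<forall>i. x $ i \<in> {0..1}"
      using \<open>copula L\<close> by (simp add: copula_def)
    ultimately have "AE x in L. lp_norm p x \<le> K"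
      by (auto elim: eventually_mono)
    then have "AE z in \<rho> \<Otimes>\<^sub>M \<mu>. lp_norm p (fst z *\<^sub>R snd z) \<le> K"
      unfolding L by (simp add: AE_distr_iff split_beta)
    then have "AE r in \<rho>. AE u in \<mu>. lp_norm p (r *\<^sub>R u) \<le> K"
      using P.AE_pair by fastforce
    \<comment> \<open>The direction has norm \<open>1\<close> almost surely, so
      \<open>lp_norm p (r *\<^sub>R u)\<close> is the absolute value of \<open>r\<close>.\<close>
    then show "AE r in \<rho>. \<bar>r\<bar> \<le> K"
    proof eventually_elim
      case (elim r)
      with AE_lp_norm_lp_uniform_pos[OF p, where 'n='n]
      have "AE u in \<mu>. \<bar>r\<bar> \<le> K"
        unfolding \<mu>_def by eventually_elim (simp add: lp_norm_scaleR[OF p])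
      then show ?case by simp
    qed
  qed
  obtain \<rho> where \<rho>: "real_distribution \<rho>" "AE r in \<rho>. 0 \<le> r" "M = distr (\<rho> \<Otimes>\<^sub>M \<mu>) borel (\<lambda>(r, u). r *\<^sub>R u)"
    using M unfolding positive_lp_spherical_copula_def lp_spherical_pos_iff[OF prob] \<mu>_def by blast
  obtain \<sigma> where \<sigma>: "real_distribution \<sigma>" "AE r in \<sigma>. 0 \<le> r" "N = distr (\<sigma> \<Otimes>\<^sub>M \<mu>) borel (\<lambda>(r, u). r *\<^sub>R u)"
    using N unfolding positive_lp_spherical_copula_def lp_spherical_pos_iff[OF prob] \<mu>_def by blast
  have cop: "copula M" "copula N"
    using M N by (auto simp: positive_lp_spherical_copula_def)
  note 1 = *[OF \<rho>(1,3) cop(1)] and 2 = *[OF \<sigma>(1,3) cop(2)]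
  have abs_moment: "(\<integral>x. x ^ k \<partial>\<tau>) = enn2real (\<integral>\<^sup>+x. ennreal (\<bar>x\<bar> ^ k) \<partial>\<tau>)"
    if "real_distribution \<tau>" "AE r in \<tau>. 0 \<le> r" for \<tau> :: "real measure" and k
  proof -
    interpret real_distribution \<tau> by fact
    have "(\<integral>x. x ^ k \<partial>\<tau>) = (\<integral>x. \<bar>x\<bar> ^ k \<partial>\<tau>)"
      using that(2) by (intro integral_cong_AE) (auto elim: eventually_mono)
    also have "\<dots> = enn2real (\<integral>\<^sup>+x. ennreal (\<bar>x\<bar> ^ k) \<partial>\<tau>)"
      by (intro integral_eq_nn_integral) auto
    finally show ?thesis .
  qed
  have "\<rho> = \<sigma>"
  proof (rule real_distribution_eqI_bounded_moments[OF \<rho>(1) \<sigma>(1) 1(2) 2(2)])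
    fix k
    have "(\<integral>\<^sup>+r. ennreal (\<bar>r\<bar> ^ k) \<partial>\<rho>) = (\<integral>\<^sup>+r. ennreal (\<bar>r\<bar> ^ k) \<partial>\<sigma>)"
    proof -
      \<comment> \<open>A factor \<open>0\<close> or \<open>\<top>\<close> would make the product
        with the moment of \<open>\<rho>\<close> equal to \<open>0\<close> or \<open>\<top>\<close>,
        but \<open>c k\<close> is neither.\<close>
      have m: "m k \<noteq> 0" "m k \<noteq> \<top>"
        using 1(1)[of k] c_0[of k] c_top[of k] by (auto simp: ennreal_mult_top split: if_splits)
      show ?thesis
        using 1(1)[of k] 2(1)[of k] mult_divide_eq_ennreal[OF m] by metis
    qed
    then show "(\<integral>x. x ^ k \<partial>\<rho>) = (\<integral>x. x ^ k \<partial>\<sigma>)"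
      by (simp add: abs_moment[OF \<rho>(1,2)] abs_moment[OF \<sigma>(1,2)])
  qed
  then show ?thesis
    by (simp add: \<rho>(3) \<sigma>(3))
qed

subsection \<open>Existence in dimension two\<close>

text \<open>Compared with the closed quadrant only the axes, a null set, are missing, so the origin
  and its division convention never occur. \<open>B = UNIV\<close> gives the whole open
  quadrant.\<close>

definition quadrant_cone :: "real \<Rightarrow> (real ^ 2) set \<Rightarrow> (real ^ 2) set" where
  "quadrant_cone p B = {v. 0 < v $ 1 \<and> 0 < v $ 2 \<and> v /\<^sub>R lp_norm p v \<in> B}"

lemma quadrant_cone_borel [measurable]:
  assumes [measurable]: "B \<in> sets borel"
  shows "quadrant_cone p B \<in> sets borel"
  unfolding quadrant_cone_def by measurable

lemma scaleR_in_quadrant_cone: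
  assumes "0 < p" "0 < c"
  shows "c *\<^sub>R v \<in> quadrant_cone p B \<longleftrightarrow> v \<in> quadrant_cone p B"
proof -
  \<comment> \<open>A zero norm is covered by \<open>inverse 0 = 0\<close>.\<close>
  have "inverse (c * lp_norm p v) * c = inverse (lp_norm p v)"
    using assms by (cases "lp_norm p v = 0") (auto simp: field_simps)
  then have "(c *\<^sub>R v) /\<^sub>R lp_norm p (c *\<^sub>R v) = v /\<^sub>R lp_norm p v"
    using assms by (simp only: lp_norm_scaleR scaleR_scaleR abs_of_pos)
  then show ?thesis
    using assms by (simp only: quadrant_cone_def mem_Collect_eq) (simp add: zero_less_mult_iff)
qed

text \<open>Taking absolute values commutes with normalisation, so the four quadrants fold onto one.
  The factors \<open>4\<close> stay until finiteness of the volume is at hand.\<close>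

lemma emeasure_lp_uniform_pos_vec2:
  assumes p: "0 < p" and B[measurable]: "B \<in> sets borel"
  shows "emeasure (lp_uniform_pos p) B =
    4 * emeasure lborel {v \<in> quadrant_cone p B. lp_norm p v < 1} /
      (4 * emeasure lborel {v \<in> quadrant_cone p UNIV. lp_norm p v < 1})"
proof -
  \<comment> \<open>Stated for every Borel set because the denominator is the instance
    \<open>UNIV\<close>.\<close>
  have quarter: "emeasure lborel {v :: real ^ 2. lp_norm p v < 1 \<and> (\<chi> i. \<bar>(v /\<^sub>R lp_norm p v) $ i\<bar>) \<in> B} =
      4 * emeasure lborel {v \<in> quadrant_cone p B. lp_norm p v < 1}"
    if [measurable]: "B \<in> sets borel" for B
  proof -
    have dir: "(\<chi> i. \<bar>(v /\<^sub>R lp_norm p v) $ i\<bar>) = (\<chi> i. \<bar>v $ i\<bar>) /\<^sub>R lp_norm p (\<chi> i. \<bar>v $ i\<bar>)" for v :: "real ^ 2"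
      using lp_norm_nonneg[of p v] by (simp add: vec_eq_iff abs_mult lp_norm_abs)
    have "emeasure lborel {v :: real ^ 2. lp_norm p v < 1 \<and> (\<chi> i. \<bar>(v /\<^sub>R lp_norm p v) $ i\<bar>) \<in> B} =
        (\<integral>\<^sup>+v. indicator {v :: real ^ 2. lp_norm p v < 1 \<and> (\<chi> i. \<bar>(v /\<^sub>R lp_norm p v) $ i\<bar>) \<in> B} v \<partial>lborel)"
      by (rule nn_integral_indicator[symmetric]) measurable
    also have "\<dots> = (\<integral>\<^sup>+v. indicator {v :: real ^ 2. lp_norm p v < 1 \<and> v /\<^sub>R lp_norm p v \<in> B} (\<chi> i. \<bar>v $ i\<bar>) \<partial>lborel)"
      unfolding dir by (simp add: lp_norm_abs indicator_def)
    also have "\<dots> = 4 * (\<integral>\<^sup>+v. indicator {v. 0 < v $ 1 \<and> 0 < v $ 2} v *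
        indicator {v :: real ^ 2. lp_norm p v < 1 \<and> v /\<^sub>R lp_norm p v \<in> B} v \<partial>lborel)"
      by (rule nn_integral_lborel_vec2_abs) measurable
    also have "(\<integral>\<^sup>+v. indicator {v. 0 < v $ 1 \<and> 0 < v $ 2} v *
        indicator {v :: real ^ 2. lp_norm p v < 1 \<and> v /\<^sub>R lp_norm p v \<in> B} v \<partial>lborel) =
        (\<integral>\<^sup>+v. indicator {v \<in> quadrant_cone p B. lp_norm p v < 1} v \<partial>lborel)"
      by (intro nn_integral_cong) (auto simp: indicator_def quadrant_cone_def)
    finally show ?thesis by simp
  qed
  define b where "b = {v :: real ^ 2. lp_norm p v < 1}"
  have [measurable]: "b \<in> sets borel"
    by (simp add: b_def)
  have "emeasure (lp_uniform_pos p) B =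
      emeasure (uniform_measure lborel b) {v. (\<chi> i. \<bar>(v /\<^sub>R lp_norm p v) $ i\<bar>) \<in> B}"
  proof -
    have "(\<lambda>v. \<chi> i. \<bar>(v /\<^sub>R lp_norm p v) $ i\<bar>) \<in> uniform_measure lborel b \<rightarrow>\<^sub>M (borel :: (real ^ 2) measure)"
      by measurable
    from emeasure_distr[OF this B] show ?thesis
      unfolding lp_uniform_pos_eq_distr b_def[symmetric] by (simp add: vimage_def)
  qed
  also have "\<dots> = emeasure lborel (b \<inter> {v. (\<chi> i. \<bar>(v /\<^sub>R lp_norm p v) $ i\<bar>) \<in> B}) / emeasure lborel b"
  proof (rule emeasure_uniform_measure)
    show "{v. (\<chi> i. \<bar>(v /\<^sub>R lp_norm p v) $ i\<bar>) \<in> B} \<in> sets lborel"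
      unfolding sets_lborel by measurable
  qed simp
  also have "b \<inter> {v. (\<chi> i. \<bar>(v /\<^sub>R lp_norm p v) $ i\<bar>) \<in> B} =
      {v. lp_norm p v < 1 \<and> (\<chi> i. \<bar>(v /\<^sub>R lp_norm p v) $ i\<bar>) \<in> B}"
    by (auto simp: b_def)
  finally show ?thesis
    using quarter[of B] quarter[of UNIV] by (simp add: b_def)
qed

text \<open>On the quadrant the density depends on the norm alone, so polar integration over the
  cone of directions \<open>B\<close> splits the mass into \<open>\<kappa> B\<close> times a radial
  integral: norm and direction are independent. Total mass \<open>1\<close> makes
  \<open>\<kappa> UNIV\<close> nonzero and the bounded ball makes it finite, whence the direction
  law is a probability measure.\<close>

lemma
  fixes h :: "real \<Rightarrow> ennreal" and p :: real
  defines "\<nu> \<equiv> density lborel (\<lambda>v :: real ^ 2. indicator {v. 0 < v $ 1 \<and> 0 < v $ 2} v * h (lp_norm p v))"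
  assumes p: "0 < p" and h[measurable]: "h \<in> borel_measurable borel" and prob: "prob_space \<nu>"
  shows prob_space_lp_uniform_pos_vec2: "prob_space (lp_uniform_pos p :: (real ^ 2) measure)"
    and lp_spherical_pos_density: "lp_spherical_pos p \<nu>"
proof -
  interpret \<nu>: prob_space \<nu> by fact
  have [measurable_cong, simp]: "sets \<nu> = sets borel" and [simp]: "space \<nu> = UNIV"
    by (simp_all add: \<nu>_def)
  define \<mu> where "\<mu> = (lp_uniform_pos p :: (real ^ 2) measure)"
  have sets_\<mu>[measurable_cong, simp]: "sets \<mu> = sets borel" and [simp]: "space \<mu> = UNIV"
    by (simp_all add: \<mu>_def lp_uniform_pos_def)
  define \<kappa> where "\<kappa> B = emeasure lborel {v \<in> quadrant_cone p B. lp_norm p v < 1}" for B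
  \<comment> \<open>The factor \<open>2 * r\<close> is the polar weight
    \<open>n * r ^ (n - 1)\<close> for \<open>n = 2\<close>.\<close>
  define w where "w = (\<lambda>r::real. ennreal (indicator {0<..} r * (2 * r)) * h r)"
  have w[measurable]: "w \<in> borel_measurable borel"
    by (simp add: w_def)
  have polar: "emeasure \<nu> {v. lp_norm p v \<in> A \<and> v /\<^sub>R lp_norm p v \<in> B} = \<kappa> B * (\<integral>\<^sup>+r. w r * indicator A r \<partial>lborel)"
    if [measurable]: "A \<in> sets borel" "B \<in> sets borel" for A B
  proof -
    have "emeasure \<nu> {v. lp_norm p v \<in> A \<and> v /\<^sub>R lp_norm p v \<in> B} =
        (\<integral>\<^sup>+v. indicator (quadrant_cone p B) v * (h (lp_norm p v) * indicator A (lp_norm p v)) \<partial>lborel)"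
      unfolding \<nu>_def
      by (subst emeasure_density) (auto simp: indicator_def quadrant_cone_def intro!: nn_integral_cong)
    also have "\<dots> = \<kappa> B * (\<integral>\<^sup>+r. w r * indicator A r \<partial>lborel)"
      by (subst nn_integral_cone_lp_norm[OF p _ scaleR_in_quadrant_cone[OF p], where h="\<lambda>r. h r * indicator A r"])
        (auto simp: \<kappa>_def w_def mult.assoc)
    finally show ?thesis .
  qed
  have total: "\<kappa> UNIV * (\<integral>\<^sup>+r. w r \<partial>lborel) = 1"
    using polar[of UNIV UNIV] \<nu>.emeasure_space_1 by simp
  then have \<kappa>_0: "\<kappa> UNIV \<noteq> 0" by auto
  have "\<kappa> UNIV \<le> emeasure lborel {v :: real ^ 2. lp_norm p v < 1}"
    unfolding \<kappa>_def by (rule emeasure_mono) auto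
  then have \<kappa>_top: "\<kappa> UNIV \<noteq> \<top>"
    using emeasure_lp_ball_finite[OF p, where 'n=2] by (auto simp: top_unique)
  then have \<kappa>_less: "\<kappa> UNIV < \<top>"
    by (simp add: less_top)
  have \<mu>: "emeasure \<mu> B = \<kappa> B / \<kappa> UNIV" if "B \<in> sets borel" for B
  proof -
    have "4 * \<kappa> B / (4 * \<kappa> UNIV) = (4 / 4) * (\<kappa> B / \<kappa> UNIV)"
      using \<kappa>_top by (simp only: divide_ennreal_def ennreal_inverse_mult less_top ennreal_numeral_less_top mult_ac)
    also have "\<dots> = \<kappa> B / \<kappa> UNIV"
      by (subst ennreal_divide_self) auto
    finally have "4 * \<kappa> B / (4 * \<kappa> UNIV) = \<kappa> B / \<kappa> UNIV" .
    then show ?thesis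
      using emeasure_lp_uniform_pos_vec2[OF p that] by (simp add: \<mu>_def \<kappa>_def)
  qed
  interpret \<mu>: prob_space \<mu>
    by (rule prob_spaceI) (use \<mu>[of UNIV] \<kappa>_0 \<kappa>_less in simp)
  show *: "prob_space (lp_uniform_pos p :: (real ^ 2) measure)"
    using \<mu>.prob_space_axioms by (simp add: \<mu>_def)
  \<comment> \<open>The law of the norm under \<open>\<nu>\<close>, read off from
    \<open>polar\<close> with \<open>B = UNIV\<close>.\<close>
  define \<rho> where "\<rho> = density lborel (\<lambda>r. \<kappa> UNIV * w r)"
  have emeasure_\<rho>: "emeasure \<rho> A = \<kappa> UNIV * (\<integral>\<^sup>+r. w r * indicator A r \<partial>lborel)" if "A \<in> sets borel" for A
    using that by (simp add: \<rho>_def emeasure_density mult.assoc nn_integral_cmult)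
  interpret \<rho>: prob_space \<rho>
    by (rule prob_spaceI) (use emeasure_\<rho>[of UNIV] total in \<open>simp add: \<rho>_def\<close>)
  have \<rho>: "real_distribution \<rho>"
    by unfold_locales (simp_all add: \<rho>_def)
  have nonneg: "AE r in \<rho>. 0 \<le> r"
    unfolding \<rho>_def by (subst AE_density) (auto simp: w_def indicator_def intro!: AE_I2)
  \<comment> \<open>It suffices to compare rectangles, where \<open>\<kappa> UNIV\<close> in the
    radial law cancels the denominator in the direction law.\<close>
  have "\<rho> \<Otimes>\<^sub>M \<mu> = distr \<nu> (borel \<Otimes>\<^sub>M borel) (\<lambda>v. (lp_norm p v, v /\<^sub>R lp_norm p v))"
  proof (rule pair_measure_eqI)
    fix A B assume "A \<in> sets \<rho>" "B \<in> sets \<mu>"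
    then have [measurable]: "A \<in> sets borel" "B \<in> sets borel"
      by (simp_all add: \<rho>_def)
    have "emeasure \<rho> A * emeasure \<mu> B = \<kappa> B * (\<integral>\<^sup>+r. w r * indicator A r \<partial>lborel)"
    proof -
      have "\<kappa> UNIV * (\<kappa> B / \<kappa> UNIV) = \<kappa> B"
        using \<kappa>_0 \<kappa>_top by (simp add: ennreal_times_divide mult_divide_eq_ennreal mult.commute)
      then show ?thesis
        by (simp add: emeasure_\<rho> \<mu>) (metis mult.commute mult.assoc)
    qed
    also have "\<dots> = emeasure (distr \<nu> (borel \<Otimes>\<^sub>M borel) (\<lambda>v. (lp_norm p v, v /\<^sub>R lp_norm p v))) (A \<times> B)"
      by (simp add: polar[symmetric] emeasure_distr vimage_def)
    finally show "emeasure \<rho> A * emeasure \<mu> B =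
        emeasure (distr \<nu> (borel \<Otimes>\<^sub>M borel) (\<lambda>v. (lp_norm p v, v /\<^sub>R lp_norm p v))) (A \<times> B)" .
  qed (auto simp: \<rho>_def \<rho>.sigma_finite_measure_axioms \<mu>.sigma_finite_measure_axioms
      intro!: sets_pair_measure_cong \<rho>.sigma_finite_measure_axioms[unfolded \<rho>_def])
  then have "distr (\<rho> \<Otimes>\<^sub>M \<mu>) borel (\<lambda>(r, u). r *\<^sub>R u) =
      distr \<nu> borel (\<lambda>v. lp_norm p v *\<^sub>R (v /\<^sub>R lp_norm p v))"
    by (simp add: distr_distr comp_def)
  also have "(\<lambda>v :: real ^ 2. lp_norm p v *\<^sub>R (v /\<^sub>R lp_norm p v)) = (\<lambda>v. v)"
  proof
    show "lp_norm p v *\<^sub>R (v /\<^sub>R lp_norm p v) = v" for v :: "real ^ 2"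
      by (cases "v = 0") (simp_all add: lp_norm_eq_0_iff[OF p])
  qed
  also have "distr \<nu> borel (\<lambda>v. v) = \<nu>"
    by (rule distr_id2) simp
  finally show "lp_spherical_pos p \<nu>"
    unfolding lp_spherical_pos_iff[OF *] using \<rho> nonneg by (intro exI[of _ \<rho>]) (simp add: \<mu>_def)
qed

section \<open>The explicit density: fibre integrals, marginals and radial form\<close>

definition lp_copula_density :: "real \<Rightarrow> real \<Rightarrow> real \<Rightarrow> real" where
  "lp_copula_density p x y =
    (if 0 < x \<and> 0 < y \<and> x powr p + y powr p < 1
     then 1 / (Gamma (1 - 1 / p) * Gamma (1 + 1 / p) * (1 - x powr p - y powr p) powr (1 / p))
     else 0)"

lemma borel_measurable_lp_copula_density [measurable (raw)]:
  assumes [measurable]: "f \<in> borel_measurable M" "g \<in> borel_measurable M"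
  shows "(\<lambda>x. lp_copula_density p (f x) (g x)) \<in> borel_measurable M"
  unfolding lp_copula_density_def by measurable

lemma lp_copula_density_commute: "lp_copula_density p x y = lp_copula_density p y x"
  by (simp add: lp_copula_density_def conj_commute conj_left_commute add.commute diff_diff_add)

text \<open>With \<open>s powr p = 1 - x powr p\<close>, the term
  \<open>1 - x powr p - (s * t) powr p\<close> equals \<open>s powr p * (1 - t powr p)\<close>. Its
  root contributes \<open>1 / s\<close>, which cancels the Jacobian \<open>s\<close>; the integral
  that remains is the normalising constant.\<close>

lemma nn_integral_lp_copula_density:
  assumes "1 < p"
  shows "(\<integral>\<^sup>+y. ennreal (lp_copula_density p x y) \<partial>lborel) = indicator {0<..<1} x"
proof (cases "x \<in> {0<..<1}")
  case True
  define G where "G = Gamma (1 - 1 / p) * Gamma (1 + 1 / p)"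
  have G: "0 < G"
    using assms by (auto simp: G_def intro!: mult_pos_pos Gamma_real_pos add_pos_pos)
  \<comment> \<open>The density vanishes on the fibre over \<open>x\<close> unless \<open>y\<close>
    lies between \<open>0\<close> and \<open>s\<close>.\<close>
  define s where "s = (1 - x powr p) powr (1 / p)"
  have xp: "x powr p < 1"
    using True assms powr_less_mono2[of p x 1] by simp
  then have s: "0 < s"
    by (simp add: s_def)
  have sp: "s powr p = 1 - x powr p"
    using xp assms by (simp add: s_def powr_powr)
  \<comment> \<open>The summand \<open>0\<close> matches the form of the affine substitution
    below.\<close>
  have *: "lp_copula_density p x (0 + s * t) =
      (1 / (G * s)) * (indicator {0<..<1} t * (1 - t powr p) powr (- (1 / p)))" for t
  proof (cases "0 < t")
    case t: True
    have "(s * t) powr p = (1 - x powr p) * t powr p"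
      using s t by (simp add: powr_mult sp)
    then have eq: "1 - x powr p - (s * t) powr p = (1 - x powr p) * (1 - t powr p)"
      by (simp add: algebra_simps)
    have "x powr p + (s * t) powr p < 1 \<longleftrightarrow> 0 < (1 - x powr p) * (1 - t powr p)"
      using eq by linarith
    also have "\<dots> \<longleftrightarrow> t powr p < 1"
      using xp by (simp add: zero_less_mult_iff)
    also have "\<dots> \<longleftrightarrow> t < 1"
      using t assms powr_less_mono2[of p t 1] powr_mono2[of p 1 t] by (cases "t < 1") auto
    finally have less: "x powr p + (s * t) powr p < 1 \<longleftrightarrow> t < 1" .
    show ?thesis
    proof (cases "t < 1")
      case t1: True
      then have "t powr p < 1"
        using t assms powr_less_mono2[of p t 1] by simp
      then have "(1 - x powr p - (s * t) powr p) powr (1 / p) = s * (1 - t powr p) powr (1 / p)"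
        by (subst eq, subst powr_mult) (simp_all add: s_def)
      with less t t1 s True show ?thesis
        by (simp add: lp_copula_density_def G_def powr_minus field_simps)
    qed (use less in \<open>simp add: lp_copula_density_def\<close>)
  next
    case False
    then show ?thesis
      using s by (simp add: lp_copula_density_def zero_less_mult_iff)
  qed
  have "(\<integral>\<^sup>+y. ennreal (lp_copula_density p x y) \<partial>lborel) =
      ennreal s * (\<integral>\<^sup>+t. ennreal (lp_copula_density p x (0 + s * t)) \<partial>lborel)"
    using s by (subst nn_integral_real_affine[where c=s and t=0]) auto
  also have "(\<integral>\<^sup>+t. ennreal (lp_copula_density p x (0 + s * t)) \<partial>lborel) =
      ennreal (1 / (G * s)) * (\<integral>\<^sup>+t. ennreal (indicator {0<..<1} t * (1 - t powr p) powr (- (1 / p))) \<partial>lborel)"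
    unfolding * using G s by (subst ennreal_mult) (auto simp: nn_integral_cmult)
  also have "\<dots> = ennreal (1 / s)"
    using G s by (simp add: nn_integral_one_minus_powr[OF assms] G_def[symmetric] ennreal_mult[symmetric])
  finally show ?thesis
    using s True by (simp add: ennreal_mult[symmetric])
next
  case False
  have "lp_copula_density p x y = 0" for y
  proof -
    have "1 \<le> x powr p" if "0 < x"
      using False that assms powr_mono2[of p 1 x] by auto
    then show ?thesis
      by (auto simp: lp_copula_density_def not_less) (smt (verit) powr_ge_zero)
  qed
  with False show ?thesis by simp
qed

definition lp_copula :: "real \<Rightarrow> (real ^ 2) measure" where
  "lp_copula p = density lborel (\<lambda>v. ennreal (lp_copula_density p (v $ 1) (v $ 2)))"

lemma sets_lp_copula [measurable_cong, simp]: "sets (lp_copula p) = sets borel"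
  by (simp add: lp_copula_def)

text \<open>The first marginal is read off from the fibre integral. For the second, symmetry of the
  density and Tonelli's theorem exchange the roles of the coordinates.\<close>

lemma marginal_lp_copula:
  assumes "1 < p"
  shows "distr (lp_copula p) borel (\<lambda>v. v $ i) = uniform_measure lborel {0<..<1}"
proof (rule measure_eqI)
  fix A assume "A \<in> sets (distr (lp_copula p) borel (\<lambda>v. v $ i))"
  then have A[measurable]: "A \<in> sets borel" by simp
  have "emeasure (distr (lp_copula p) borel (\<lambda>v. v $ i)) A =
      (\<integral>\<^sup>+v. ennreal (lp_copula_density p (v $ 1) (v $ 2)) * indicator A (v $ i) \<partial>lborel)"
    by (simp add: nn_integral_indicator[symmetric] nn_integral_distr lp_copula_def nn_integral_density
        del: nn_integral_indicator)
  also have "\<dots> = (\<integral>\<^sup>+x. \<integral>\<^sup>+y. ennreal (lp_copula_density p x y) * indicator A (vector [x, y] $ i) \<partial>lborel \<partial>lborel)"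
    by (subst nn_integral_lborel_vec2) auto
  also have "\<dots> = (\<integral>\<^sup>+x. \<integral>\<^sup>+y. ennreal (lp_copula_density p x y) * indicator A x \<partial>lborel \<partial>lborel)"
  proof (cases "i = 1")
    case False
    then have "i = 2"
      using exhaust_2[of i] by blast
    then have "(\<integral>\<^sup>+x. \<integral>\<^sup>+y. ennreal (lp_copula_density p x y) * indicator A (vector [x, y] $ i) \<partial>lborel \<partial>lborel) =
        (\<integral>\<^sup>+x. \<integral>\<^sup>+y. ennreal (lp_copula_density p y x) * indicator A y \<partial>lborel \<partial>lborel)"
      by (simp add: lp_copula_density_commute)
    also have "\<dots> = (\<integral>\<^sup>+y. \<integral>\<^sup>+x. ennreal (lp_copula_density p y x) * indicator A y \<partial>lborel \<partial>lborel)"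
      by (rule lborel_pair.Fubini') measurable
    finally show ?thesis .
  qed simp
  also have "\<dots> = (\<integral>\<^sup>+x. indicator {0<..<1} x * indicator A x \<partial>lborel)"
    by (simp add: nn_integral_multc nn_integral_lp_copula_density[OF assms])
  also have "\<dots> = emeasure lborel ({0<..<1} \<inter> A)"
    by (simp add: indicator_inter_arith[symmetric])
  finally show "emeasure (distr (lp_copula p) borel (\<lambda>v. v $ i)) A = emeasure (uniform_measure lborel {0<..<1}) A"
    by (simp add: divide_ennreal_def)
qed simp

text \<open>The total mass is that of the first marginal, which is already known to be
  uniform.\<close>

lemma prob_space_lp_copula:
  assumes "1 < p"
  shows "prob_space (lp_copula p)"
proof (rule prob_space_distrD)
  show "(\<lambda>v. v $ 1) \<in> lp_copula p \<rightarrow>\<^sub>M (borel :: real measure)"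
    by measurable
  show "prob_space (distr (lp_copula p) borel (\<lambda>v. v $ 1))"
    unfolding marginal_lp_copula[OF assms] by (rule prob_space_uniform_measure) auto
qed

lemma copula_lp_copula:
  assumes "1 < p"
  shows "copula (lp_copula p)"
proof -
  have "v $ i \<in> {0..1}" if "lp_copula_density p (v $ 1) (v $ 2) \<noteq> 0" for v :: "real ^ 2" and i
  proof -
    have *: "0 < v $ 1" "0 < v $ 2" "(v $ 1) powr p + (v $ 2) powr p < 1"
      using that by (auto simp: lp_copula_density_def split: if_splits)
    have "(v $ 1) powr p < 1" "(v $ 2) powr p < 1"
      using * powr_ge_zero[of "v $ 1" p] powr_ge_zero[of "v $ 2" p] by linarith+
    with * have "(v $ i) powr p < 1" "0 < v $ i"
      using exhaust_2[of i] by auto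
    then show ?thesis
      using assms powr_mono2[of p 1 "v $ i"] by (cases "v $ i \<le> 1") auto
  qed
  then have "AE v in lp_copula p. \<forall>i. v $ i \<in> {0..1}"
    unfolding lp_copula_def by (subst AE_density) (auto intro!: AE_I2 gr_zeroI)
  then show ?thesis
    by (simp add: copula_def prob_space_lp_copula[OF assms] marginal_lp_copula[OF assms])
qed

text \<open>On the open quadrant \<open>lp_norm p v powr p\<close> is the sum of the two powers.
  This gives the density the radial form that \<open>lp_spherical_pos_density\<close> takes.\<close>

lemma lp_copula_eq:
  assumes "0 < p"
  shows "lp_copula p = density lborel (\<lambda>v. indicator {v. 0 < v $ 1 \<and> 0 < v $ 2} v *
    ennreal (if lp_norm p v < 1
      then 1 / (Gamma (1 - 1 / p) * Gamma (1 + 1 / p) * (1 - lp_norm p v powr p) powr (1 / p)) else 0))"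
  unfolding lp_copula_def
proof (intro arg_cong[where f="density lborel"] ext)
  fix v :: "real ^ 2"
  show "ennreal (lp_copula_density p (v $ 1) (v $ 2)) = indicator {v. 0 < v $ 1 \<and> 0 < v $ 2} v *
    ennreal (if lp_norm p v < 1
      then 1 / (Gamma (1 - 1 / p) * Gamma (1 + 1 / p) * (1 - lp_norm p v powr p) powr (1 / p)) else 0)"
  proof (cases "0 < v $ 1 \<and> 0 < v $ 2")
    case True
    then have powr: "lp_norm p v powr p = (v $ 1) powr p + (v $ 2) powr p"
      using assms by (simp add: lp_norm_def UNIV_2 powr_powr)
    have "lp_norm p v < 1 \<longleftrightarrow> lp_norm p v powr p < 1"
      using assms lp_norm_nonneg[of p v] powr_less_mono2[of p "lp_norm p v" 1] powr_mono2[of p 1 "lp_norm p v"]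
      by (cases "lp_norm p v < 1") auto
    with True powr show ?thesis
      by (simp add: lp_copula_density_def diff_diff_add)
  qed (auto simp: lp_copula_density_def)
qed

theorem theorem7:
  fixes p :: real and M :: "(real ^ 2) measure"
  assumes "1 < p"
  shows "positive_lp_spherical_copula p M \<longleftrightarrow>
    M = density lborel (\<lambda>v. ennreal (let x = v $ 1; y = v $ 2 in
      if 0 < x \<and> 0 < y \<and> x powr p + y powr p < 1
      then 1 / (Gamma (1 - 1 / p) * Gamma (1 + 1 / p) *
                (1 - x powr p - y powr p) powr (1 / p))
      else 0))"
proof -
  \<comment> \<open>The radial profile of the density, as a function of the norm.\<close>
  define h where "h = (\<lambda>r. ennreal (if r < 1
    then 1 / (Gamma (1 - 1 / p) * Gamma (1 + 1 / p) * (1 - r powr p) powr (1 / p)) else 0))"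
  have p: "0 < p" using assms by simp
  have h: "h \<in> borel_measurable borel"
    unfolding h_def by measurable
  have eq: "lp_copula p = density lborel (\<lambda>v. indicator {v. 0 < v $ 1 \<and> 0 < v $ 2} v * h (lp_norm p v))"
    by (simp add: lp_copula_eq[OF p] h_def)
  \<comment> \<open>Serves twice: for the spherical form of the density, and for the probability
    property of the direction law that uniqueness requires.\<close>
  note prob = prob_space_lp_copula[OF assms, unfolded eq]
  have "positive_lp_spherical_copula p (lp_copula p)"
    using lp_spherical_pos_density[OF p h prob] copula_lp_copula[OF assms]
    by (simp add: positive_lp_spherical_copula_def eq)
  then have "positive_lp_spherical_copula p M \<longleftrightarrow> M = lp_copula p"
    using positive_lp_spherical_copula_unique[OF p prob_space_lp_uniform_pos_vec2[OF p h prob]] by blast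
  then show ?thesis
    by (simp add: lp_copula_def lp_copula_density_def Let_def)
qed

end
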